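(* Let $\Delta$ be a convex union representable simplicial complex, and let $\sigma\in\Delta$ be an arbitrary face. Then $\Delta$ collapses onto the star $\operatorname{St}_\Delta(\sigma)$. In particular, if $\sigma\neq\emptyset$, then $\Delta$ collapses onto the simplex $\overline{\sigma}=2^\sigma$.
   Context: A simplicial complex on a finite ground set $\mathcal V$ is a collection $\Delta$ of subsets of $\mathcal V$ (faces) closed under inclusion; elements of $\mathcal V$ need not be vertices. The void complex $\emptyset$ (no faces) is allowed and is distinct from the empty complex $\{\emptyset\}$. Facets are inclusion-maximal faces. The star of a face $\sigma$ is $\operatorname{St}_\Delta(\sigma)=\{\tau\in\Delta\mid \tau\cup\sigma\in\Delta\}$. The deletion is $\Delta\setminus\sigma=\{\tau\in\Delta\mid\tau\not\supseteq\sigma\}$. A face $\sigma$ that is not a facet is free if it is contained in a unique facet; then $\Delta\to\Delta\setminus\sigma$ is an elementary collapse. (The empty face may be used as a free face.) $\Delta$ collapses onto $\Gamma$ if there is a (possibly empty) finite sequence of elementary collapses starting with $\Delta$ and ending with $\Gamma$. For a collection $\mathcal U=\{U_1,\dots,U_n\}$ of convex subsets of $\mathbb R^d$ (the empty set is convex, open and closed), put $U_\sigma=\bigcap_{i\in\sigma}U_i$ for $\emptyset\ne\sigma\subseteq[n]$ and $U_\emptyset=\operatorname{conv}(\bigcup_i U_i)$. The nerve is $\mathcal N(\mathcal U)=\{\sigma\subseteq[n]\mid U_\sigma\neq\emptyset\}$ (so it is the void complex if all $U_i$ are empty). A complex $\Delta\subseteq 2^{[n]}$ is $d$-convex union representable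 ($d\ge 0$ an integer) if $\Delta=\mathcal N(\mathcal U)$ for some collection $\mathcal U=\{U_i\}_{i=1}^n$ of convex open sets in $\mathbb R^d$ whose union is convex. It is convex union representable if it is $d$-convex union representable for some $d$. *)

theory Defs
  imports "HOL-Analysis.Analysis" "HOL-Analysis.Finite_Function_Topology"
begin

(* The ground set V is explicit, since its elements need not be vertices. The void complex {}
   is allowed and differs from the empty complex {{}}. *)
definition abstract_simplicial_complex :: "'a set \<Rightarrow> 'a set set \<Rightarrow> bool" where
  "abstract_simplicial_complex V \<Delta> \<longleftrightarrow>
     finite V \<and> \<Delta> \<subseteq> Pow V \<and> (\<forall>\<sigma>\<in>\<Delta>. \<forall>\<tau>. \<tau> \<subseteq> \<sigma> \<longrightarrow> \<tau> \<in> \<Delta>)"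

definition facet :: "'a set set \<Rightarrow> 'a set \<Rightarrow> bool" where
  "facet \<Delta> \<sigma> \<longleftrightarrow> \<sigma> \<in> \<Delta> \<and> (\<forall>\<tau>\<in>\<Delta>. \<sigma> \<subseteq> \<tau> \<longrightarrow> \<tau> = \<sigma>)"

definition star :: "'a set set \<Rightarrow> 'a set \<Rightarrow> 'a set set" where
  "star \<Delta> \<sigma> = {\<tau> \<in> \<Delta>. \<tau> \<union> \<sigma> \<in> \<Delta>}"

definition deletion :: "'a set set \<Rightarrow> 'a set \<Rightarrow> 'a set set" where
  "deletion \<Delta> \<sigma> = {\<tau> \<in> \<Delta>. \<not> \<sigma> \<subseteq> \<tau>}"

(* The empty face is not excluded: it is free iff \<Delta> is a full simplex on a nonempty set,
   and collapsing it yields the void complex. *)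
definition free_face :: "'a set set \<Rightarrow> 'a set \<Rightarrow> bool" where
  "free_face \<Delta> \<sigma> \<longleftrightarrow> \<sigma> \<in> \<Delta> \<and> \<not> facet \<Delta> \<sigma> \<and> (\<exists>!\<phi>. facet \<Delta> \<phi> \<and> \<sigma> \<subseteq> \<phi>)"

definition elementary_collapse :: "'a set set \<Rightarrow> 'a set set \<Rightarrow> bool" where
  "elementary_collapse \<Delta> \<Gamma> \<longleftrightarrow> (\<exists>\<sigma>. free_face \<Delta> \<sigma> \<and> \<Gamma> = deletion \<Delta> \<sigma>)"

definition collapses_onto :: "'a set set \<Rightarrow> 'a set set \<Rightarrow> bool" where
  "collapses_onto = elementary_collapse\<^sup>*\<^sup>*"

(* The space of d-tuples of reals, for d a natural number (d = 0 included) that is quantified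
   over inside formulas: the finitely supported sequences that vanish from index d on. This is
   a linear subspace of a normed space, so convex sets and hulls are the library's; its
   topology is the subspace topology, given by the l1-metric on coordinates (see
   dist_Rspace below), i.e. the usual one. *)
definition Rspace :: "nat \<Rightarrow> (nat \<Rightarrow>\<^sub>0 real) set" where
  "Rspace d = {x. \<forall>i\<ge>d. Poly_Mapping.lookup x i = 0}"

lemma dist_Rspace:
  assumes "x \<in> Rspace d" "y \<in> Rspace d"
  shows "dist x y = (\<Sum>i<d. \<bar>Poly_Mapping.lookup x i - Poly_Mapping.lookup y i\<bar>)"
proof -
  let ?K = "Poly_Mapping.keys x \<union> Poly_Mapping.keys y"
  have sub: "?K \<subseteq> {..<d}"
  proof
    fix i assume "i \<in> ?K"
    then have "Poly_Mapping.lookup x i \<noteq> 0 \<or> Poly_Mapping.lookup y i \<noteq> 0"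
      by (simp add: in_keys_iff)
    then have "\<not> d \<le> i"
      using assms unfolding Rspace_def by blast
    then show "i \<in> {..<d}" by simp
  qed
  have "(\<Sum>i\<in>?K. \<bar>Poly_Mapping.lookup x i - Poly_Mapping.lookup y i\<bar>) =
        (\<Sum>i<d. \<bar>Poly_Mapping.lookup x i - Poly_Mapping.lookup y i\<bar>)"
    using sub by (rule sum.mono_neutral_left[OF finite_lessThan]) (simp add: in_keys_iff)
  then show ?thesis
    by (simp only: dist_poly_mapping_def dist_real_def)
qed

(* For the empty index set this is not the intersection but the convex hull of the union. *)
definition nerve_cell :: "'a set \<Rightarrow> ('a \<Rightarrow> 'b::real_vector set) \<Rightarrow> 'a set \<Rightarrow> 'b set" where
  "nerve_cell V U \<sigma> = (if \<sigma> = {} then convex hull (\<Union>i\<in>V. U i) else (\<Inter>i\<in>\<sigma>. U i))"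

definition nerve :: "'a set \<Rightarrow> ('a \<Rightarrow> 'b::real_vector set) \<Rightarrow> 'a set set" where
  "nerve V U = {\<sigma>. \<sigma> \<subseteq> V \<and> nerve_cell V U \<sigma> \<noteq> {}}"

(* The sets are indexed by the ground set V itself; the classical case is V = {1..n}. *)
definition d_convex_union_representable :: "nat \<Rightarrow> 'a set \<Rightarrow> 'a set set \<Rightarrow> bool" where
  "d_convex_union_representable d V \<Delta> \<longleftrightarrow>
     (\<exists>U :: 'a \<Rightarrow> (nat \<Rightarrow>\<^sub>0 real) set.
        (\<forall>i\<in>V. convex (U i) \<and> openin (top_of_set (Rspace d)) (U i)) \<and>
        convex (\<Union>i\<in>V. U i) \<and>
        \<Delta> = nerve V U)"

definition convex_union_representable :: "'a set \<Rightarrow> 'a set set \<Rightarrow> bool" where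
  "convex_union_representable V \<Delta> \<longleftrightarrow> (\<exists>d. d_convex_union_representable d V \<Delta>)"

end

theory Submission
  imports Defs
begin

text \<open>
  The star of \<open>\<sigma>\<close> in the nerve of a family is the nerve of the same family traced on the cell of
  \<open>\<sigma>\<close>. The first claim is therefore a case of a geometric statement: if \<open>X\<close> is compact convex,
  \<open>C\<close> is closed convex, and closed convex sets \<open>U i\<close> cover the part of \<open>X\<close> outside \<open>C\<close>, then the
  nerve traced on \<open>X\<close> collapses onto the nerve traced on \<open>X \<inter> C\<close>
  (\<open>nerve_over_collapses_onto_convex_subset\<close>). Here the empty face has the cell \<open>X\<close>. A
  representation by open sets is first shrunk to compact sets with the same nerve
  (\<open>open_cover_compact_shrinking\<close>), and the cell of \<open>\<sigma>\<close> then serves as \<open>C\<close>.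

  The geometric statement is proved by a sweep. Take a strictly convex \<open>f\<close> with a sublevel set
  that contains \<open>X \<inter> C\<close> and misses every cell that misses \<open>C\<close>, such as the distance to \<open>C\<close> plus a
  small multiple of a strictly convex function, and shrink \<open>X\<close> through the sublevel sets of \<open>f\<close>.
  A face disappears when the level passes the minimum of \<open>f\<close> on its cell, and by strict convexity
  that minimum is attained at one point only. Hence the faces can be removed one minimizer \<open>p\<close> at a
  time. All faces that disappear at \<open>p\<close> lie in the simplex on \<open>T = {i. p \<in> U i}\<close>, and \<open>T\<close> itself
  is one of them. The faces of this simplex that survive form the nerve of the sets \<open>U i\<close>,
  \<open>i \<in> T\<close>, traced on \<open>Y\<close>, the points of \<open>X\<close> near \<open>p\<close> at which \<open>f\<close> is below \<open>f p\<close>. This set is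
  again convex and covered by these \<open>U i\<close>. What remains to be seen is that the full simplex on \<open>T\<close>
  collapses onto that nerve.

  For this fix \<open>a \<in> T\<close>. The simplex is a cone with apex \<open>a\<close> and collapses onto the cone over the
  nerve of the other sets. The faces of this cone still to be removed are those which contain \<open>a\<close>
  and whose rest is a face of the nerve of the other sets on \<open>Y\<close> but not on \<open>Y \<inter> U a\<close>. The other
  sets cover \<open>Y - U a\<close>, so the geometric statement for the smaller index set \<open>T - {a}\<close>, with
  \<open>C = U a\<close>, removes them, once \<open>Y\<close> is replaced by a compact part with the same nerve. The whole
  argument is thus one induction on the index set, and asking for a cover of \<open>X - C\<close> rather than of
  \<open>X\<close> is what lets it close.

  The second claim follows since the star of a nonempty \<open>\<sigma>\<close> is a cone with apex in \<open>\<sigma>\<close>.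
\<close>

section \<open>Collapses of set families\<close>

lemma collapses_onto_refl [simp]: "collapses_onto \<Delta> \<Delta>"
  by (simp add: collapses_onto_def)

lemma collapses_onto_trans [trans]:
  "collapses_onto \<Delta> \<Gamma> \<Longrightarrow> collapses_onto \<Gamma> \<Lambda> \<Longrightarrow> collapses_onto \<Delta> \<Lambda>"
  unfolding collapses_onto_def by (rule rtranclp_trans)

lemma elementary_collapse_imp_collapses_onto:
  "elementary_collapse \<Delta> \<Gamma> \<Longrightarrow> collapses_onto \<Delta> \<Gamma>"
  by (simp add: collapses_onto_def)

lemma collapses_onto_subset: "collapses_onto \<Delta> \<Gamma> \<Longrightarrow> \<Gamma> \<subseteq> \<Delta>"
  unfolding collapses_onto_def
  by (induction rule: rtranclp_induct)
    (auto simp: elementary_collapse_def deletion_def)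

definition down_closed :: "'a set set \<Rightarrow> bool" where
  "down_closed \<Delta> \<longleftrightarrow> (\<forall>\<sigma>\<in>\<Delta>. \<forall>\<tau>\<subseteq>\<sigma>. \<tau> \<in> \<Delta>)"

lemma down_closedD: "down_closed \<Delta> \<Longrightarrow> \<sigma> \<in> \<Delta> \<Longrightarrow> \<tau> \<subseteq> \<sigma> \<Longrightarrow> \<tau> \<in> \<Delta>"
  by (auto simp: down_closed_def)

text \<open>
  A collapse of \<open>K\<close> extends to a larger complex: each face that is used as a free face lies
  outside \<open>L\<close>, hence outside \<open>A\<close>, and then so does every face above it. The facets above it are
  thus the same in \<open>K\<close> and in the union. The case of interest is \<open>K\<close> a simplex or a family of faces
  through a common vertex; the latter is not closed under subsets, so \<open>K\<close> is an arbitrary family.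
\<close>
lemma collapses_onto_Un:
  assumes "collapses_onto K L" and A: "down_closed A" and "A \<inter> K \<subseteq> L"
  shows "collapses_onto (A \<union> K) (A \<union> L)"
  using assms(1,3) unfolding collapses_onto_def
proof (induction rule: converse_rtranclp_induct)
  case (step K M)
  have LM: "L \<subseteq> M"
    using step.hyps(2) collapses_onto_subset by (simp add: collapses_onto_def)
  obtain \<sigma> where \<sigma>: "free_face K \<sigma>" and M: "M = deletion K \<sigma>"
    using step.hyps(1) by (auto simp: elementary_collapse_def)
  have above: "\<tau> \<notin> A" if "\<sigma> \<subseteq> \<tau>" for \<tau>
  proof
    assume "\<tau> \<in> A"
    then have "\<sigma> \<in> A \<inter> K"
      using that down_closedD[OF A] \<sigma> by (auto simp: free_face_def)
    then show False
      using step.prems LM M by (auto simp: deletion_def)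
  qed
  have facets: "facet (A \<union> K) \<phi> \<longleftrightarrow> facet K \<phi>" if "\<sigma> \<subseteq> \<phi>" for \<phi>
  proof -
    have "\<tau> \<notin> A" if "\<phi> \<subseteq> \<tau>" for \<tau>
      using above that \<open>\<sigma> \<subseteq> \<phi>\<close> by blast
    then show ?thesis
      unfolding facet_def by blast
  qed
  have "free_face (A \<union> K) \<sigma>"
    using \<sigma> facets unfolding free_face_def by blast
  moreover have "A \<union> M = deletion (A \<union> K) \<sigma>"
    using above M by (auto simp: deletion_def)
  ultimately have "elementary_collapse (A \<union> K) (A \<union> M)"
    by (auto simp: elementary_collapse_def)
  moreover have "A \<inter> M \<subseteq> L"
    using step.prems M by (auto simp: deletion_def)
  ultimately show ?case
    using step.IH by (meson converse_rtranclp_into_rtranclp)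
qed simp

lemma elementary_collapse_insert_image:
  assumes "elementary_collapse K L" and a: "\<And>\<tau>. \<tau> \<in> K \<Longrightarrow> a \<notin> \<tau>"
  shows "elementary_collapse (insert a ` K) (insert a ` L)"
proof -
  obtain \<sigma> where \<sigma>: "free_face K \<sigma>" and L: "L = deletion K \<sigma>"
    using assms(1) by (auto simp: elementary_collapse_def)
  have sub: "insert a \<tau> \<subseteq> insert a \<tau>' \<longleftrightarrow> \<tau> \<subseteq> \<tau>'" if "\<tau> \<in> K" "\<tau>' \<in> K" for \<tau> \<tau>'
    using a that by blast
  have eq: "insert a \<tau> = insert a \<tau>' \<longleftrightarrow> \<tau> = \<tau>'" if "\<tau> \<in> K" "\<tau>' \<in> K" for \<tau> \<tau>'
    using sub[OF that] sub[OF that(2,1)] by (auto simp only: set_eq_subset)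
  have facets: "facet (insert a ` K) (insert a \<tau>) \<longleftrightarrow> facet K \<tau>" if "\<tau> \<in> K" for \<tau>
  proof -
    have "(\<forall>\<rho>\<in>K. insert a \<tau> \<subseteq> insert a \<rho> \<longrightarrow> insert a \<rho> = insert a \<tau>)
        \<longleftrightarrow> (\<forall>\<rho>\<in>K. \<tau> \<subseteq> \<rho> \<longrightarrow> \<rho> = \<tau>)"
      by (intro ball_cong refl) (simp only: sub[OF that] eq[OF _ that])
    then show ?thesis
      using that by (simp add: facet_def del: insert_subset)
  qed
  have \<sigma>K: "\<sigma> \<in> K"
    using \<sigma> by (simp add: free_face_def)
  obtain \<phi> where \<phi>: "facet K \<phi>" "\<sigma> \<subseteq> \<phi>"
    and uniq: "\<And>\<psi>. facet K \<psi> \<Longrightarrow> \<sigma> \<subseteq> \<psi> \<Longrightarrow> \<psi> = \<phi>"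
    using \<sigma> unfolding free_face_def by blast
  have "\<exists>!\<psi>. facet (insert a ` K) \<psi> \<and> insert a \<sigma> \<subseteq> \<psi>"
  proof (rule ex1I[of _ "insert a \<phi>"])
    show "facet (insert a ` K) (insert a \<phi>) \<and> insert a \<sigma> \<subseteq> insert a \<phi>"
      using \<phi> facets by (auto simp: facet_def)
  next
    fix \<psi> assume \<psi>: "facet (insert a ` K) \<psi> \<and> insert a \<sigma> \<subseteq> \<psi>"
    then obtain \<tau> where \<tau>: "\<tau> \<in> K" "\<psi> = insert a \<tau>"
      by (auto simp: facet_def)
    then show "\<psi> = insert a \<phi>"
      using \<psi> \<sigma>K facets sub uniq by auto
  qed
  then have "free_face (insert a ` K) (insert a \<sigma>)"
    using \<sigma> \<sigma>K facets by (auto simp: free_face_def)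
  moreover have "insert a ` L = deletion (insert a ` K) (insert a \<sigma>)"
    unfolding L deletion_def using a[OF \<sigma>K] by auto
  ultimately show ?thesis
    by (auto simp: elementary_collapse_def)
qed

lemma collapses_onto_insert_image:
  assumes "collapses_onto K L" and "\<And>\<tau>. \<tau> \<in> K \<Longrightarrow> a \<notin> \<tau>"
  shows "collapses_onto (insert a ` K) (insert a ` L)"
  using assms unfolding collapses_onto_def
proof (induction rule: converse_rtranclp_induct)
  case (step K M)
  have "M \<subseteq> K"
    using step.hyps(1) by (auto simp: elementary_collapse_def deletion_def)
  then show ?case
    using step elementary_collapse_insert_image
    by (meson converse_rtranclp_into_rtranclp subsetD)
qed simp

definition cone_over :: "'a \<Rightarrow> 'a set set \<Rightarrow> 'a set set" where
  "cone_over a K = K \<union> insert a ` K"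

text \<open>
  Removing a maximal \<open>\<sigma> \<in> K - L\<close> is an elementary collapse of the cone, since the only face properly
  above \<open>\<sigma>\<close> is \<open>insert a \<sigma>\<close>. For \<open>L = {}\<close> the last step uses the free face \<open>{}\<close>.
\<close>
lemma cone_over_collapses_onto:
  assumes "finite K" and "down_closed K" and "down_closed L" and "L \<subseteq> K"
    and a: "\<And>\<tau>. \<tau> \<in> K \<Longrightarrow> a \<notin> \<tau>"
  shows "collapses_onto (cone_over a K) (cone_over a L)"
  using assms
proof (induction "card (K - L)" arbitrary: K rule: less_induct)
  case less
  show ?case
  proof (cases "K = L")
    case False
    then have "finite (K - L)" "K - L \<noteq> {}"
      using less.prems by auto
    then obtain \<sigma> where \<sigma>: "\<sigma> \<in> K - L"
      and max: "\<And>\<tau>. \<tau> \<in> K - L \<Longrightarrow> \<sigma> \<subseteq> \<tau> \<Longrightarrow> \<tau> = \<sigma>"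
      using finite_has_maximal[of "K - L"] by (metis (no_types, lifting))
    have above: "\<tau> = \<sigma>" if "\<tau> \<in> K" "\<sigma> \<subseteq> \<tau>" for \<tau>
      using that \<sigma> max down_closedD[OF \<open>down_closed L\<close>] by blast
    have a\<sigma>: "a \<notin> \<sigma>"
      using \<sigma> less.prems by auto
    have above': "\<tau> = \<sigma> \<or> \<tau> = insert a \<sigma>" if "\<tau> \<in> cone_over a K" "\<sigma> \<subseteq> \<tau>" for \<tau>
      using that above a\<sigma> unfolding cone_over_def by blast
    have in_cone: "\<sigma> \<in> cone_over a K" "insert a \<sigma> \<in> cone_over a K"
      using \<sigma> by (auto simp: cone_over_def)
    have "facet (cone_over a K) (insert a \<sigma>)"
      using in_cone above' unfolding facet_def by blast
    moreover have "\<not> facet (cone_over a K) \<sigma>"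
      using in_cone a\<sigma> unfolding facet_def by blast
    ultimately have "free_face (cone_over a K) \<sigma>"
      using in_cone above' unfolding free_face_def by (metis facet_def subset_insertI)
    moreover have "cone_over a (K - {\<sigma>}) = deletion (cone_over a K) \<sigma>"
      using above above' a\<sigma> less.prems(5) unfolding cone_over_def deletion_def by blast
    ultimately have "collapses_onto (cone_over a K) (cone_over a (K - {\<sigma>}))"
      by (auto intro!: elementary_collapse_imp_collapses_onto simp: elementary_collapse_def)
    also have "collapses_onto (cone_over a (K - {\<sigma>})) (cone_over a L)"
    proof (rule less.hyps)
      show "card (K - {\<sigma>} - L) < card (K - L)"
        using \<sigma> \<open>finite (K - L)\<close> by (intro psubset_card_mono) auto
      show "down_closed (K - {\<sigma>})"
        using above down_closedD[OF less.prems(2)] unfolding down_closed_def by blast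
    qed (use less.prems \<sigma> in auto)
    finally show ?thesis .
  qed simp
qed

section \<open>Strictly convex functions\<close>

definition strictly_convex_on :: "'b::real_vector set \<Rightarrow> ('b \<Rightarrow> real) \<Rightarrow> bool" where
  "strictly_convex_on S f \<longleftrightarrow> convex S \<and>
     (\<forall>x\<in>S. \<forall>y\<in>S. \<forall>u. x \<noteq> y \<longrightarrow> 0 < u \<longrightarrow> u < 1 \<longrightarrow>
        f ((1 - u) *\<^sub>R x + u *\<^sub>R y) < (1 - u) * f x + u * f y)"

lemma strictly_convex_on_subset:
  "strictly_convex_on S f \<Longrightarrow> T \<subseteq> S \<Longrightarrow> convex T \<Longrightarrow> strictly_convex_on T f"
  unfolding strictly_convex_on_def by blast

lemma strictly_convex_on_imp_convex_on:
  assumes "strictly_convex_on S f"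
  shows "convex_on S f"
proof
  fix u :: real and x y assume *: "0 < u" "u < 1" "x \<in> S" "y \<in> S"
  show "f ((1 - u) *\<^sub>R x + u *\<^sub>R y) \<le> (1 - u) * f x + u * f y"
  proof (cases "x = y")
    case True
    then show ?thesis by (simp flip: scaleR_add_left distrib_right)
  next
    case False
    then show ?thesis
      using assms * unfolding strictly_convex_on_def by (metis less_imp_le)
  qed
qed (use assms in \<open>simp add: strictly_convex_on_def\<close>)

lemma strictly_convex_on_convex_plus:
  assumes "convex_on S f" and "strictly_convex_on S g" and "0 < e"
  shows "strictly_convex_on S (\<lambda>x. f x + e * g x)"
  unfolding strictly_convex_on_def
proof (intro conjI ballI allI impI)
  fix x y u assume *: "x \<in> S" "y \<in> S" "x \<noteq> y" "0 < u" "u < (1::real)"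
  have "f ((1 - u) *\<^sub>R x + u *\<^sub>R y) \<le> (1 - u) * f x + u * f y"
    using convex_onD[OF assms(1)] * by simp
  moreover have "e * g ((1 - u) *\<^sub>R x + u *\<^sub>R y) < e * ((1 - u) * g x + u * g y)"
    using assms(2,3) * unfolding strictly_convex_on_def by (intro mult_strict_left_mono) blast+
  ultimately show "f ((1 - u) *\<^sub>R x + u *\<^sub>R y) + e * g ((1 - u) *\<^sub>R x + u *\<^sub>R y)
      < (1 - u) * (f x + e * g x) + u * (f y + e * g y)"
    by (simp add: algebra_simps)
qed (use assms(2) in \<open>simp add: strictly_convex_on_def\<close>)

lemma strictly_convex_on_minimizer_unique:
  assumes f: "strictly_convex_on S f" and "x \<in> S" "y \<in> S"
    and min: "\<And>z. z \<in> S \<Longrightarrow> f x \<le> f z" and "f y \<le> f x"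
  shows "y = x"
proof (rule ccontr)
  assume "y \<noteq> x"
  define z where "z = (1 - 1/2) *\<^sub>R x + (1/2) *\<^sub>R y"
  have "z \<in> S"
    using f assms(2,3) unfolding z_def by (intro convexD_alt) (auto simp: strictly_convex_on_def)
  moreover have "f z < (1 - 1/2) * f x + (1/2) * f y"
    unfolding z_def using f assms(2,3) \<open>y \<noteq> x\<close> unfolding strictly_convex_on_def
    by (metis half_gt_zero_iff less_numeral_extra(1) one_less_numeral_iff semiring_norm(76)
        divide_less_eq_1_pos zero_less_numeral)
  ultimately show False
    using min[of z] \<open>f y \<le> f x\<close> by (simp add: field_simps)
qed

lemma convex_on_infdist:
  fixes C :: "'b::real_normed_vector set"
  assumes "convex C" and "C \<noteq> {}" and "convex S"
  shows "convex_on S (\<lambda>x. infdist x C)"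
proof
  fix u :: real and x y :: 'b assume u: "0 < u" "u < 1"
  show "infdist ((1 - u) *\<^sub>R x + u *\<^sub>R y) C \<le> (1 - u) * infdist x C + u * infdist y C"
  proof (rule field_le_epsilon)
    fix e :: real assume "0 < e"
    obtain a where a: "a \<in> C" "dist x a < infdist x C + e"
      using cInf_lessD[of "dist x ` C" "infdist x C + e"] \<open>C \<noteq> {}\<close> \<open>0 < e\<close>
      by (auto simp: infdist_notempty)
    obtain b where b: "b \<in> C" "dist y b < infdist y C + e"
      using cInf_lessD[of "dist y ` C" "infdist y C + e"] \<open>C \<noteq> {}\<close> \<open>0 < e\<close>
      by (auto simp: infdist_notempty)
    have ab: "(1 - u) *\<^sub>R a + u *\<^sub>R b \<in> C"
      using a b u \<open>convex C\<close> by (simp add: convex_alt)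
    have "dist ((1 - u) *\<^sub>R x + u *\<^sub>R y) ((1 - u) *\<^sub>R a + u *\<^sub>R b)
        = norm ((1 - u) *\<^sub>R (x - a) + u *\<^sub>R (y - b))"
      by (simp add: dist_norm algebra_simps)
    also have "\<dots> \<le> norm ((1 - u) *\<^sub>R (x - a)) + norm (u *\<^sub>R (y - b))"
      by (rule norm_triangle_ineq)
    also have "\<dots> = (1 - u) * dist x a + u * dist y b"
      using u by (simp add: dist_norm)
    also have "\<dots> \<le> (1 - u) * (infdist x C + e) + u * (infdist y C + e)"
      using a b u by (intro add_mono mult_left_mono) auto
    finally show "infdist ((1 - u) *\<^sub>R x + u *\<^sub>R y) C
        \<le> (1 - u) * infdist x C + u * infdist y C + e"
      using infdist_le[OF ab, of "(1 - u) *\<^sub>R x + u *\<^sub>R y"] by (simp add: algebra_simps)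
  qed
qed (rule \<open>convex S\<close>)

text \<open>
  The distance to \<open>C\<close> is convex and separates \<open>C\<close> from \<open>K\<close>. Adding a multiple of the bounded function
  \<open>g\<close> that is small against the gap makes it strictly convex and keeps the separation.
\<close>
lemma strictly_convex_sublevel_separation:
  fixes X :: "'b::real_normed_vector set"
  assumes "compact X" and g: "continuous_on X g" "strictly_convex_on X g"
    and C: "convex C" "closed C"
    and K: "compact K" "K \<subseteq> X" "K \<inter> C = {}"
  obtains f r where "continuous_on X f" "strictly_convex_on X f"
    and "\<And>x. x \<in> X \<inter> C \<Longrightarrow> f x \<le> r" and "\<And>x. x \<in> K \<Longrightarrow> r < f x"
proof -
  obtain B0 where B0: "\<And>x. x \<in> X \<Longrightarrow> \<bar>g x\<bar> \<le> B0"
    using compact_imp_bounded[OF compact_continuous_image[OF g(1) \<open>compact X\<close>]]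
    by (auto simp: bounded_iff)
  define B where "B = max 1 B0"
  have B: "0 < B" "\<And>x. x \<in> X \<Longrightarrow> \<bar>g x\<bar> \<le> B"
    using B0 by (force simp: B_def)+
  show thesis
  proof (cases "C = {}")
    case True
    show thesis
    proof (rule that[OF g, of "- B - 1"])
      fix x assume "x \<in> K"
      then have "\<bar>g x\<bar> \<le> B" using K B by blast
      then show "- B - 1 < g x" by linarith
    qed (use True in auto)
  next
    case False
    obtain d where d: "0 < d" "\<And>x. x \<in> K \<Longrightarrow> d \<le> infdist x C"
    proof (cases "K = {}")
      case False
      have cont: "continuous_on K (\<lambda>x. infdist x C)"
        by (intro continuous_intros)
      obtain y where y: "y \<in> K" "\<And>x. x \<in> K \<Longrightarrow> infdist y C \<le> infdist x C"
        using continuous_attains_inf[OF K(1) False cont] by auto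
      have "y \<notin> C"
        using y K by auto
      then have "0 < infdist y C"
        using infdist_pos_not_in_closed[OF C(2) \<open>C \<noteq> {}\<close>] by simp
      then show thesis
        using y that by blast
    qed (use that[of 1] in auto)
    \<comment> \<open>The perturbation is at most \<open>d / 4\<close> in size, so on \<open>K\<close> the sum is at least \<open>3 / 4 * d\<close>.\<close>
    define e where "e = d / (4 * B)"
    have e: "0 < e" "e * B = d / 4"
      using B d by (auto simp: e_def)
    have bound: "\<bar>e * g x\<bar> \<le> d / 4" if "x \<in> X" for x
      using mult_left_mono[OF B(2)[OF that], of e] e by (simp add: abs_mult)
    show thesis
    proof (rule that[of "\<lambda>x. infdist x C + e * g x" "d / 4"])
      show "continuous_on X (\<lambda>x. infdist x C + e * g x)"
        by (intro continuous_intros g)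
      show "strictly_convex_on X (\<lambda>x. infdist x C + e * g x)"
        using g(2) e(1) C(1) False
        by (intro strictly_convex_on_convex_plus convex_on_infdist)
          (auto simp: strictly_convex_on_def)
      show "infdist x C + e * g x \<le> d / 4" if "x \<in> X \<inter> C" for x
        using that bound[of x] by auto
      show "d / 4 < infdist x C + e * g x" if "x \<in> K" for x
        using that d(1) d(2)[OF that] bound[of x] K(2) by (auto simp: abs_le_iff)
    qed
  qed
qed

section \<open>Nerves relative to a convex set\<close>

text \<open>
  The empty face has the cell \<open>X\<close>, by the convention on empty intersections. When \<open>X\<close> is the union
  of the family and convex, this agrees with the convex hull in the definition of \<open>nerve\<close>.
\<close>
definition nerve_over :: "'a set \<Rightarrow> ('a \<Rightarrow> 'b set) \<Rightarrow> 'b set \<Rightarrow> 'a set set" where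
  "nerve_over V U X = {\<sigma>. \<sigma> \<subseteq> V \<and> X \<inter> (\<Inter>i\<in>\<sigma>. U i) \<noteq> {}}"

lemma nerve_overI:
  "\<sigma> \<subseteq> V \<Longrightarrow> y \<in> X \<Longrightarrow> (\<And>i. i \<in> \<sigma> \<Longrightarrow> y \<in> U i) \<Longrightarrow> \<sigma> \<in> nerve_over V U X"
  unfolding nerve_over_def by blast

lemma finite_nerve_over: "finite V \<Longrightarrow> finite (nerve_over V U X)"
  by (rule finite_subset[of _ "Pow V"]) (auto simp: nerve_over_def)

lemma down_closed_nerve_over: "down_closed (nerve_over V U X)"
  unfolding down_closed_def nerve_over_def by blast

lemma nerve_over_mono: "X \<subseteq> Y \<Longrightarrow> nerve_over V U X \<subseteq> nerve_over V U Y"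
  unfolding nerve_over_def by blast

text \<open>One point chosen from each nonempty cell suffices to span a compact set with the same nerve.\<close>
lemma compact_convex_core:
  fixes Y :: "'b::real_normed_vector set"
  assumes "finite V" and "convex Y"
  obtains Q where "Q \<subseteq> Y" "compact Q" "convex Q" "nerve_over V U Q = nerve_over V U Y"
proof -
  have "\<forall>\<sigma>\<in>nerve_over V U Y. \<exists>x. x \<in> Y \<inter> (\<Inter>i\<in>\<sigma>. U i)"
    unfolding nerve_over_def by blast
  then obtain x where x: "\<And>\<sigma>. \<sigma> \<in> nerve_over V U Y \<Longrightarrow> x \<sigma> \<in> Y \<inter> (\<Inter>i\<in>\<sigma>. U i)"
    by metis
  define Q where "Q = convex hull (x ` nerve_over V U Y)"
  have "Q \<subseteq> Y"
    unfolding Q_def using x \<open>convex Y\<close> by (intro hull_minimal) auto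
  moreover have "compact Q"
    unfolding Q_def using finite_nerve_over[OF \<open>finite V\<close>]
    by (intro finite_imp_compact_convex_hull) auto
  moreover have "\<sigma> \<in> nerve_over V U Q" if "\<sigma> \<in> nerve_over V U Y" for \<sigma>
    using that x[OF that] hull_inc[of "x \<sigma>" "x ` nerve_over V U Y" convex]
    unfolding nerve_over_def Q_def by auto
  ultimately show thesis
    using that[of Q] nerve_over_mono[of Q Y V U] convex_convex_hull unfolding Q_def by blast
qed

text \<open>
  The nerve \<open>N\<close> on \<open>T\<close> arises from the nerve \<open>A\<close> on \<open>T - {a}\<close> by coning only the link of \<open>a\<close>, which
  is the nerve on \<open>T - {a}\<close> traced on the set with index \<open>a\<close>. The simplex first collapses onto the
  full cone over \<open>A\<close>. A collapse of \<open>A\<close> onto the link, which the last assumption supplies, is then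
  carried out among the faces through \<open>a\<close>.
\<close>
lemma Pow_collapses_onto_nerve_over:
  fixes Y :: "'b::real_normed_vector set"
  assumes "finite T" and a: "a \<in> T" and "convex Y"
    and U: "\<And>i. i \<in> T \<Longrightarrow> convex (U i) \<and> closed (U i)"
    and cover: "Y \<subseteq> (\<Union>i\<in>T. U i)"
    and link: "\<And>X C. compact X \<Longrightarrow> convex X \<Longrightarrow> X \<subseteq> Y \<Longrightarrow> convex C \<Longrightarrow> closed C \<Longrightarrow>
        X - C \<subseteq> (\<Union>i\<in>T - {a}. U i) \<Longrightarrow>
        collapses_onto (nerve_over (T - {a}) U X) (nerve_over (T - {a}) U (X \<inter> C))"
  shows "collapses_onto (Pow T) (nerve_over T U Y)"
proof -
  obtain Q where Q: "Q \<subseteq> Y" "compact Q" "convex Q" "nerve_over T U Q = nerve_over T U Y"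
    using compact_convex_core[OF \<open>finite T\<close> \<open>convex Y\<close>] by metis
  let ?A = "nerve_over (T - {a}) U Q" and ?L = "nerve_over (T - {a}) U (Q \<inter> U a)"
  have PowT: "Pow T = cone_over a (Pow (T - {a}))"
    using Pow_insert[of a "T - {a}"] a by (simp add: cone_over_def insert_absorb)
  have NT: "nerve_over T U Q = ?A \<union> insert a ` ?L"
  proof (intro set_eqI iffI)
    fix \<tau> assume \<tau>: "\<tau> \<in> nerve_over T U Q"
    show "\<tau> \<in> ?A \<union> insert a ` ?L"
    proof (cases "a \<in> \<tau>")
      case True
      then have "\<tau> = insert a (\<tau> - {a})" by blast
      moreover have "\<tau> - {a} \<in> ?L"
        using \<tau> True unfolding nerve_over_def by blast
      ultimately show ?thesis by blast
    next
      case False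
      then show ?thesis using \<tau> unfolding nerve_over_def by blast
    qed
  next
    fix \<tau> assume "\<tau> \<in> ?A \<union> insert a ` ?L"
    then show "\<tau> \<in> nerve_over T U Q"
      using a unfolding nerve_over_def by auto
  qed
  have "collapses_onto (cone_over a (Pow (T - {a}))) (cone_over a ?A)"
  proof (rule cone_over_collapses_onto[OF _ _ down_closed_nerve_over])
    show "down_closed (Pow (T - {a}))"
      by (auto simp: down_closed_def)
    show "?A \<subseteq> Pow (T - {a})"
      by (auto simp: nerve_over_def)
  qed (use \<open>finite T\<close> in auto)
  also have "cone_over a ?A = ?A \<union> insert a ` ?A"
    by (simp add: cone_over_def)
  also have "collapses_onto \<dots> (?A \<union> insert a ` ?L)"
  proof (rule collapses_onto_Un)
    have "collapses_onto ?A ?L"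
      using Q U[OF a] cover by (intro link) auto
    then show "collapses_onto (insert a ` ?A) (insert a ` ?L)"
      by (rule collapses_onto_insert_image) (auto simp: nerve_over_def)
    show "?A \<inter> insert a ` ?A \<subseteq> insert a ` ?L"
      by (auto simp: nerve_over_def)
  qed (rule down_closed_nerve_over)
  finally show ?thesis
    using PowT NT Q by simp
qed

section \<open>Sweeping\<close>

text \<open>
  The local form of the sweep at a point \<open>p\<close>. Whether a cell through \<open>p\<close> meets the region \<open>f < f p\<close> is
  decided arbitrarily close to \<open>p\<close>, because the segment from \<open>p\<close> to a point of the cell in that region
  stays in the cell and, except for \<open>p\<close>, in the region. Close to \<open>p\<close> only the sets through \<open>p\<close> matter,
  so these cover, and the assumption on simplices applies.
\<close>
lemma Pow_collapses_at_point:
  fixes X :: "'b::real_normed_vector set"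
  assumes "finite V" and "convex X"
    and U: "\<And>i. i \<in> V \<Longrightarrow> convex (U i) \<and> closed (U i)"
    and f: "continuous_on X f" "strictly_convex_on X f"
    and p: "p \<in> X" "r < f p"
    and cover: "\<And>x. x \<in> X \<Longrightarrow> r < f x \<Longrightarrow> \<exists>i\<in>V. x \<in> U i"
    and Pow: "\<And>T Y. T \<subseteq> V \<Longrightarrow> T \<noteq> {} \<Longrightarrow> convex Y \<Longrightarrow> Y \<subseteq> X \<Longrightarrow> Y \<subseteq> (\<Union>i\<in>T. U i) \<Longrightarrow>
        collapses_onto (Pow T) (nerve_over T U Y)"
  shows "collapses_onto (Pow {i\<in>V. p \<in> U i})
    {\<tau> \<in> Pow {i\<in>V. p \<in> U i}. \<exists>q\<in>X \<inter> (\<Inter>i\<in>\<tau>. U i). f q < f p}"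
proof -
  define T where "T = {i\<in>V. p \<in> U i}"
  have "closed (\<Union>i\<in>V - T. U i)"
    using \<open>finite V\<close> U by (intro closed_UN) auto
  moreover have "p \<in> - (\<Union>i\<in>V - T. U i)"
    by (simp add: T_def)
  ultimately obtain e1 where e1: "0 < e1" "ball p e1 \<subseteq> - (\<Union>i\<in>V - T. U i)"
    by (meson open_Compl open_contains_ball)
  obtain e2 where e2: "0 < e2" "\<And>x. x \<in> X \<Longrightarrow> dist x p < e2 \<Longrightarrow> dist (f x) (f p) < f p - r"
    using f(1) p unfolding continuous_on_iff by (metis diff_gt_0_iff_gt)
  define e where "e = min e1 e2"
  define Y where "Y = {x \<in> X. f x < f p} \<inter> ball p e"
  have "0 < e"
    using e1 e2 by (simp add: e_def)
  have f_conv: "convex_on X f"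
    by (rule strictly_convex_on_imp_convex_on[OF f(2)])
  have "convex {x \<in> X. f x < f p}"
    unfolding convex_alt
  proof (intro ballI allI impI)
    fix x y u assume *: "x \<in> {x \<in> X. f x < f p}" "y \<in> {x \<in> X. f x < f p}" "0 \<le> u \<and> u \<le> (1::real)"
    have "f ((1 - u) *\<^sub>R x + u *\<^sub>R y) \<le> (1 - u) * f x + u * f y"
      using convex_onD[OF f_conv] * by simp
    also have "\<dots> < f p"
      using * by (intro convex_bound_lt) auto
    finally show "(1 - u) *\<^sub>R x + u *\<^sub>R y \<in> {x \<in> X. f x < f p}"
      using * \<open>convex X\<close> by (simp add: convex_alt)
  qed
  then have "convex Y"
    unfolding Y_def by (intro convex_Int convex_ball)
  have "Y \<subseteq> (\<Union>i\<in>T. U i)"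
  proof
    fix x assume x: "x \<in> Y"
    then have "dist (f x) (f p) < f p - r"
      by (intro e2(2)) (auto simp: Y_def e_def dist_commute)
    then have "r < f x"
      by (auto simp: dist_real_def)
    then obtain i where "i \<in> V" "x \<in> U i"
      using cover x unfolding Y_def by blast
    moreover have "x \<in> ball p e1"
      using x by (auto simp: Y_def e_def)
    ultimately show "x \<in> (\<Union>i\<in>T. U i)"
      using e1(2) by blast
  qed
  moreover have "T \<noteq> {}"
    using cover p by (auto simp: T_def)
  ultimately have "collapses_onto (Pow T) (nerve_over T U Y)"
    using Pow[of T Y] \<open>convex Y\<close> by (auto simp: T_def Y_def)
  also have "nerve_over T U Y = {\<tau> \<in> Pow T. \<exists>q\<in>X \<inter> (\<Inter>i\<in>\<tau>. U i). f q < f p}" (is "_ = ?K")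
  proof
    show "nerve_over T U Y \<subseteq> ?K"
      by (auto simp: nerve_over_def Y_def)
    show "?K \<subseteq> nerve_over T U Y"
    proof
      fix \<tau> assume "\<tau> \<in> ?K"
      then obtain q where \<tau>: "\<tau> \<subseteq> T" and q: "q \<in> X" "\<And>i. i \<in> \<tau> \<Longrightarrow> q \<in> U i" "f q < f p"
        by auto
      have pq: "0 < dist p q"
        using q(3) by auto
      define u where "u = min (1/2) (e / (2 * dist p q))"
      have u: "0 < u" "u < 1"
        using \<open>0 < e\<close> pq by (auto simp: u_def)
      have "u \<le> e / (2 * dist p q)"
        by (simp add: u_def)
      then have "u * dist p q \<le> e / 2"
        using pq by (simp add: pos_le_divide_eq mult.commute)
      then have ud: "u * dist p q < e"
        using \<open>0 < e\<close> by linarith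
      define z where "z = (1 - u) *\<^sub>R p + u *\<^sub>R q"
      have "z \<in> X"
        using \<open>convex X\<close> p q u by (simp add: convex_alt z_def)
      moreover have "f z < f p"
      proof -
        have "f z \<le> (1 - u) * f p + u * f q"
          using convex_onD[OF f_conv] p q u by (simp add: z_def)
        also have "\<dots> < (1 - u) * f p + u * f p"
          using q u by simp
        finally show ?thesis
          by (simp add: algebra_simps)
      qed
      moreover have "z \<in> ball p e"
      proof -
        have "p - z = u *\<^sub>R (p - q)"
          by (simp add: z_def algebra_simps)
        then show ?thesis
          using ud u by (simp add: dist_norm)
      qed
      moreover have "z \<in> U i" if "i \<in> \<tau>" for i
        using that \<tau> q U[of i] u by (auto simp: T_def z_def convex_alt)
      ultimately have "z \<in> Y \<inter> (\<Inter>i\<in>\<tau>. U i)"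
        by (auto simp: Y_def)
      then show "\<tau> \<in> nerve_over T U Y"
        using \<tau> unfolding nerve_over_def by blast
    qed
  qed
  finally show ?thesis
    by (simp add: T_def)
qed

text \<open>
  With \<open>P \<sigma>\<close> the minimizer of \<open>f\<close> on the cell of \<open>\<sigma>\<close>, the faces with \<open>f (P \<sigma>) > r\<close> are removed in
  classes of equal \<open>P \<sigma>\<close>, in order of decreasing \<open>f (P \<sigma>)\<close>. Distinct minimizers on the same level
  can be taken in any order, so the induction runs over all complexes between the two nerves which are
  unions of such classes.
\<close>
lemma nerve_over_collapses_onto_sublevel:
  fixes X :: "'b::real_normed_vector set"
  assumes "finite V" and "compact X" and "convex X"
    and U: "\<And>i. i \<in> V \<Longrightarrow> convex (U i) \<and> closed (U i)"
    and f: "continuous_on X f" "strictly_convex_on X f"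
    and cover: "\<And>x. x \<in> X \<Longrightarrow> r < f x \<Longrightarrow> \<exists>i\<in>V. x \<in> U i"
    and Pow: "\<And>T Y. T \<subseteq> V \<Longrightarrow> T \<noteq> {} \<Longrightarrow> convex Y \<Longrightarrow> Y \<subseteq> X \<Longrightarrow> Y \<subseteq> (\<Union>i\<in>T. U i) \<Longrightarrow>
        collapses_onto (Pow T) (nerve_over T U Y)"
  shows "collapses_onto (nerve_over V U X) (nerve_over V U {x \<in> X. f x \<le> r})"
proof -
  let ?cell = "\<lambda>\<sigma>. X \<inter> (\<Inter>i\<in>\<sigma>. U i)"
  let ?N = "nerve_over V U X"
  have "\<exists>p. p \<in> ?cell \<sigma> \<and> (\<forall>q\<in>?cell \<sigma>. f p \<le> f q)" if "\<sigma> \<in> ?N" for \<sigma>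
  proof -
    have "closed (\<Inter>i\<in>\<sigma>. U i)"
      using that U by (intro closed_INT) (auto simp: nerve_over_def)
    then have "compact (?cell \<sigma>)"
      using \<open>compact X\<close> by (rule compact_Int_closed[rotated])
    moreover have "continuous_on (?cell \<sigma>) f"
      using f(1) by (rule continuous_on_subset) auto
    ultimately show ?thesis
      using continuous_attains_inf[of "?cell \<sigma>" f] that unfolding nerve_over_def by blast
  qed
  then obtain P where P: "\<And>\<sigma>. \<sigma> \<in> ?N \<Longrightarrow> P \<sigma> \<in> ?cell \<sigma>"
    and Pmin: "\<And>\<sigma> q. \<sigma> \<in> ?N \<Longrightarrow> q \<in> ?cell \<sigma> \<Longrightarrow> f (P \<sigma>) \<le> f q"
    by metis
  have Puniq: "q = P \<sigma>" if "\<sigma> \<in> ?N" "q \<in> ?cell \<sigma>" "f q \<le> f (P \<sigma>)" for \<sigma> q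
  proof (rule strictly_convex_on_minimizer_unique[where S = "?cell \<sigma>" and f = f])
    have "convex (?cell \<sigma>)"
      using that(1) U \<open>convex X\<close> by (intro convex_Int convex_INT) (auto simp: nerve_over_def)
    then show "strictly_convex_on (?cell \<sigma>) f"
      by (intro strictly_convex_on_subset[OF f(2)]) auto
  qed (use that P Pmin in blast)+
  define N0 where "N0 = {\<sigma> \<in> ?N. f (P \<sigma>) \<le> r}"
  have "N0 = nerve_over V U {x \<in> X. f x \<le> r}"
  proof
    show "N0 \<subseteq> nerve_over V U {x \<in> X. f x \<le> r}"
      using P by (fastforce simp: N0_def nerve_over_def)
    show "nerve_over V U {x \<in> X. f x \<le> r} \<subseteq> N0"
    proof
      fix \<sigma> assume \<sigma>: "\<sigma> \<in> nerve_over V U {x \<in> X. f x \<le> r}"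
      then obtain q where q: "q \<in> ?cell \<sigma>" "f q \<le> r"
        unfolding nerve_over_def by blast
      moreover have "\<sigma> \<in> ?N"
        using \<sigma> nerve_over_mono[of "{x \<in> X. f x \<le> r}" X V U] by blast
      ultimately show "\<sigma> \<in> N0"
        using Pmin[of \<sigma> q] by (auto simp: N0_def)
    qed
  qed
  moreover have "collapses_onto \<Gamma> N0"
    if "N0 \<subseteq> \<Gamma>" "\<Gamma> \<subseteq> ?N" "down_closed \<Gamma>"
      and "\<And>\<sigma> \<tau>. \<sigma> \<in> \<Gamma> \<Longrightarrow> \<tau> \<in> ?N \<Longrightarrow> P \<tau> = P \<sigma> \<Longrightarrow> \<tau> \<in> \<Gamma>" for \<Gamma>
    using that
  proof (induction "card (\<Gamma> - N0)" arbitrary: \<Gamma> rule: less_induct)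
    case less
    note \<Gamma>N = subsetD[OF less.prems(2)]
    have fin: "finite \<Gamma>"
      using less.prems(2) finite_nerve_over[OF \<open>finite V\<close>] finite_subset by blast
    show ?case
    proof (cases "\<Gamma> = N0")
      case False
      define M where "M = Max ((\<lambda>\<sigma>. f (P \<sigma>)) ` (\<Gamma> - N0))"
      have ne: "\<Gamma> - N0 \<noteq> {}"
        using False less.prems(1) by blast
      then have "M \<in> (\<lambda>\<sigma>. f (P \<sigma>)) ` (\<Gamma> - N0)"
        unfolding M_def using fin by (intro Max_in) auto
      then obtain \<sigma> where \<sigma>: "\<sigma> \<in> \<Gamma> - N0" "f (P \<sigma>) = M"
        by auto
      define p where "p = P \<sigma>"
      have rp: "r < f p"
        using \<sigma> \<Gamma>N by (auto simp: N0_def p_def)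
      have max: "f (P \<tau>) \<le> f p" if "\<tau> \<in> \<Gamma>" for \<tau>
      proof (cases "\<tau> \<in> N0")
        case True
        then show ?thesis using rp by (simp add: N0_def)
      next
        case False
        then show ?thesis
          using that fin \<sigma>(2) by (auto simp: M_def p_def intro!: Max_ge)
      qed
      have pX: "p \<in> X"
        using P[of \<sigma>] \<sigma> \<Gamma>N by (auto simp: p_def)
      define D where "D = {\<tau> \<in> \<Gamma>. P \<tau> = p}"
      define T where "T = {i\<in>V. p \<in> U i}"
      have "T \<in> ?N"
        using pX unfolding nerve_over_def T_def by blast
      have \<sigma>T: "\<sigma> \<subseteq> T"
        using P[of \<sigma>] \<sigma>(1) \<Gamma>N[of \<sigma>] by (auto simp: T_def p_def nerve_over_def)
      have "P T = p"
      proof -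
        have "p \<in> ?cell T"
          using pX by (auto simp: T_def)
        moreover have "P T \<in> ?cell \<sigma>"
          using P[OF \<open>T \<in> ?N\<close>] \<sigma>T by auto
        then have "f p \<le> f (P T)"
          using Pmin[of \<sigma> "P T"] \<sigma>(1) \<Gamma>N by (auto simp: p_def)
        ultimately show ?thesis
          using Puniq[OF \<open>T \<in> ?N\<close>, of p] by (intro sym[of p]) blast
      qed
      then have "T \<in> \<Gamma>"
        using less.prems(4)[of \<sigma> T] \<sigma>(1) \<open>T \<in> ?N\<close> by (simp add: p_def)
      have PowT: "Pow T \<subseteq> \<Gamma>"
        using down_closedD[OF less.prems(3) \<open>T \<in> \<Gamma>\<close>] by blast
      have D_T: "D \<subseteq> Pow T"
        using P \<Gamma>N by (fastforce simp: D_def T_def nerve_over_def)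
      have K: "{\<tau> \<in> Pow T. \<exists>q\<in>?cell \<tau>. f q < f p} = Pow T - D"
      proof -
        have "(\<exists>q\<in>?cell \<tau>. f q < f p) \<longleftrightarrow> \<tau> \<notin> D" if "\<tau> \<in> Pow T" for \<tau>
        proof -
          have \<tau>: "\<tau> \<in> \<Gamma>" "\<tau> \<in> ?N"
            using that PowT \<Gamma>N by auto
          have p\<tau>: "p \<in> ?cell \<tau>"
            using that pX by (auto simp: T_def)
          show ?thesis
          proof
            show "\<tau> \<notin> D" if "\<exists>q\<in>?cell \<tau>. f q < f p"
              using that Pmin[OF \<tau>(2)] by (force simp: D_def)
            assume "\<tau> \<notin> D"
            then have "f (P \<tau>) < f p"
              using Puniq[OF \<tau>(2) p\<tau>] \<tau>(1) by (force simp: D_def)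
            then show "\<exists>q\<in>?cell \<tau>. f q < f p"
              using P[OF \<tau>(2)] by blast
          qed
        qed
        then show ?thesis by blast
      qed
      \<comment> \<open>Above a removed face the cells are smaller, so their minima are no lower; as \<open>f p\<close> is the
        highest minimum, they are equal, and uniqueness gives the same minimizer.\<close>
      have dc: "down_closed (\<Gamma> - D)"
        unfolding down_closed_def
      proof (intro ballI allI impI)
        fix \<tau> \<rho> assume \<tau>: "\<tau> \<in> \<Gamma> - D" and \<rho>: "\<rho> \<subseteq> \<tau>"
        have "\<rho> \<in> \<Gamma>"
          using \<tau> \<rho> down_closedD[OF less.prems(3)] by blast
        moreover have "P \<tau> = p" if "P \<rho> = p"
        proof -
          have "P \<tau> \<in> ?cell \<rho>"
            using P[of \<tau>] \<tau> \<rho> \<Gamma>N by blast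
          then show ?thesis
            using Puniq[of \<rho> "P \<tau>"] max[of \<tau>] \<tau> that \<Gamma>N[OF \<open>\<rho> \<in> \<Gamma>\<close>] by simp
        qed
        ultimately show "\<rho> \<in> \<Gamma> - D"
          using \<tau> by (auto simp: D_def)
      qed
      have "collapses_onto (Pow T) (Pow T - D)"
        using Pow_collapses_at_point[OF \<open>finite V\<close> \<open>convex X\<close> U f pX rp cover Pow] K
        by (simp add: T_def)
      then have "collapses_onto ((\<Gamma> - D) \<union> Pow T) ((\<Gamma> - D) \<union> (Pow T - D))"
        using dc by (rule collapses_onto_Un) auto
      moreover have "(\<Gamma> - D) \<union> Pow T = \<Gamma>" "(\<Gamma> - D) \<union> (Pow T - D) = \<Gamma> - D"
        using PowT D_T by (auto simp: D_def)
      ultimately have "collapses_onto \<Gamma> (\<Gamma> - D)"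
        by simp
      also have "collapses_onto (\<Gamma> - D) N0"
      proof (rule less.hyps)
        have "\<sigma> \<in> D"
          using \<sigma>(1) by (simp add: D_def p_def)
        then show "card (\<Gamma> - D - N0) < card (\<Gamma> - N0)"
          using \<sigma>(1) fin by (intro psubset_card_mono) auto
        show "N0 \<subseteq> \<Gamma> - D"
          using less.prems(1) rp by (auto simp: D_def N0_def)
        show "\<tau> \<in> \<Gamma> - D" if "\<sigma> \<in> \<Gamma> - D" "\<tau> \<in> ?N" "P \<tau> = P \<sigma>" for \<sigma> \<tau>
          using that less.prems(4)[of \<sigma> \<tau>] by (auto simp: D_def)
      qed (use less.prems(2) dc in auto)
      finally show ?thesis .
    qed simp
  qed
  from this[of ?N] have "collapses_onto ?N N0"
    using down_closed_nerve_over[of V U X] by (auto simp: N0_def)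
  ultimately show ?thesis by simp
qed

text \<open>
  The set \<open>E\<close> only carries a strictly convex continuous function that serves every \<open>X\<close> occurring in
  the induction. A bound \<open>f \<le> r\<close> that holds on \<open>X \<inter> C\<close> but nowhere on the cells missing \<open>C\<close> makes
  the sublevel set and \<open>C\<close> meet the same cells.
\<close>
theorem nerve_over_collapses_onto_convex_subset:
  fixes E :: "'b::real_normed_vector set"
  assumes g: "continuous_on E g" "strictly_convex_on E g"
    and "finite V" and U: "\<And>i. i \<in> V \<Longrightarrow> convex (U i) \<and> closed (U i)"
    and "compact X" "convex X" "X \<subseteq> E" and "convex C" "closed C"
    and "X - C \<subseteq> (\<Union>i\<in>V. U i)"
  shows "collapses_onto (nerve_over V U X) (nerve_over V U (X \<inter> C))"
  using assms(3-)
proof (induction V arbitrary: X C rule: finite_psubset_induct)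
  case (psubset V)
  let ?cell = "\<lambda>\<sigma>. X \<inter> (\<Inter>i\<in>\<sigma>. U i)"
  define K where "K = (\<Union>\<sigma>\<in>{\<sigma>. \<sigma> \<subseteq> V \<and> ?cell \<sigma> \<inter> C = {}}. ?cell \<sigma>)"
  have "compact (?cell \<sigma>)" if "\<sigma> \<subseteq> V" for \<sigma>
    using that psubset.prems by (intro compact_Int_closed closed_INT) auto
  then have "compact K"
    unfolding K_def using \<open>finite V\<close> by (intro compact_UN) auto
  have gX: "continuous_on X g" "strictly_convex_on X g"
    using g psubset.prems continuous_on_subset strictly_convex_on_subset by blast+
  have "K \<subseteq> X" "K \<inter> C = {}"
    by (auto simp: K_def)
  then obtain f r where f: "continuous_on X f" "strictly_convex_on X f"
    and fC: "\<And>x. x \<in> X \<inter> C \<Longrightarrow> f x \<le> r" and fK: "\<And>x. x \<in> K \<Longrightarrow> r < f x"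
    using strictly_convex_sublevel_separation[OF \<open>compact X\<close> gX \<open>convex C\<close> \<open>closed C\<close> \<open>compact K\<close>]
    by metis
  have Pow: "collapses_onto (Pow T) (nerve_over T U Y)"
    if T: "T \<subseteq> V" "T \<noteq> {}" and Y: "convex Y" "Y \<subseteq> X" "Y \<subseteq> (\<Union>i\<in>T. U i)" for T Y
  proof -
    obtain a where a: "a \<in> T"
      using T by blast
    show ?thesis
    proof (rule Pow_collapses_onto_nerve_over[where a = a])
      show "finite T"
        using T \<open>finite V\<close> finite_subset by blast
      show "collapses_onto (nerve_over (T - {a}) U X') (nerve_over (T - {a}) U (X' \<inter> C'))"
        if "compact X'" "convex X'" "X' \<subseteq> Y" "convex C'" "closed C'"
          "X' - C' \<subseteq> (\<Union>i\<in>T - {a}. U i)" for X' C'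
      proof (rule psubset.IH)
        show "T - {a} \<subset> V"
          using T a by blast
      qed (use that T Y psubset.prems in auto)
    qed (use a T Y psubset.prems in auto)
  qed
  have "collapses_onto (nerve_over V U X) (nerve_over V U {x \<in> X. f x \<le> r})"
  proof (rule nerve_over_collapses_onto_sublevel[OF \<open>finite V\<close> \<open>compact X\<close> \<open>convex X\<close> _ f])
    show "\<exists>i\<in>V. x \<in> U i" if "x \<in> X" "r < f x" for x
      using that fC[of x] psubset.prems(7) by force
  qed (use psubset.prems(1) Pow in auto)
  also have "nerve_over V U {x \<in> X. f x \<le> r} = nerve_over V U (X \<inter> C)"
  proof
    show "nerve_over V U {x \<in> X. f x \<le> r} \<subseteq> nerve_over V U (X \<inter> C)"
    proof
      fix \<sigma> assume "\<sigma> \<in> nerve_over V U {x \<in> X. f x \<le> r}"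
      then obtain q where \<sigma>: "\<sigma> \<subseteq> V" and q: "q \<in> ?cell \<sigma>" "f q \<le> r"
        unfolding nerve_over_def by blast
      have "q \<notin> K"
        using q fK[of q] by auto
      then have "?cell \<sigma> \<inter> C \<noteq> {}"
        using \<sigma> q unfolding K_def by blast
      then show "\<sigma> \<in> nerve_over V U (X \<inter> C)"
        using \<sigma> unfolding nerve_over_def by blast
    qed
    show "nerve_over V U (X \<inter> C) \<subseteq> nerve_over V U {x \<in> X. f x \<le> r}"
      using fC by (intro nerve_over_mono) auto
  qed
  finally show ?case .
qed

section \<open>Open covers in coordinate space\<close>

lemma lookup_scaleR:
  "Poly_Mapping.lookup (r *\<^sub>R x) i = r *\<^sub>R Poly_Mapping.lookup x i"
  by (simp add: scaleR_poly_mapping_def)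

lemma subspace_Rspace: "subspace (Rspace d)"
  by (auto simp: subspace_def Rspace_def lookup_add lookup_scaleR)

lemma continuous_on_lookup:
  fixes S :: "('a \<Rightarrow>\<^sub>0 real) set"
  shows "continuous_on S (\<lambda>x. Poly_Mapping.lookup x i)"
proof -
  have "dist (Poly_Mapping.lookup x i) (Poly_Mapping.lookup y i) \<le> dist x y" for x y :: "'a \<Rightarrow>\<^sub>0 real"
  proof (cases "i \<in> Poly_Mapping.keys x \<union> Poly_Mapping.keys y")
    case True
    then show ?thesis
      unfolding dist_poly_mapping_def by (intro member_le_sum) auto
  qed (auto simp: in_keys_iff)
  then show ?thesis
    unfolding continuous_on_iff by (meson le_less_trans)
qed

lemma strictly_convex_on_sum_squares:
  "strictly_convex_on (Rspace d) (\<lambda>x. \<Sum>i<d. (Poly_Mapping.lookup x i)\<^sup>2)"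
  unfolding strictly_convex_on_def
proof (intro conjI ballI allI impI)
  show "convex (Rspace d)"
    by (rule subspace_imp_convex[OF subspace_Rspace])
next
  fix x y u assume *: "x \<in> Rspace d" "y \<in> Rspace d" "x \<noteq> y" "0 < u" "u < (1::real)"
  let ?l = "Poly_Mapping.lookup"
  let ?z = "(1 - u) *\<^sub>R x + u *\<^sub>R y"
  have gap: "(1 - u) * (?l x i)\<^sup>2 + u * (?l y i)\<^sup>2 - (?l ?z i)\<^sup>2 = u * (1 - u) * (?l x i - ?l y i)\<^sup>2" for i
    unfolding lookup_add lookup_scaleR by (simp add: power2_eq_square algebra_simps)
  obtain j where j: "?l x j \<noteq> ?l y j"
    using \<open>x \<noteq> y\<close> by (auto simp: poly_mapping_eq_iff fun_eq_iff)
  have "j < d"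
  proof (rule ccontr)
    assume "\<not> j < d"
    then have "?l x j = 0" "?l y j = 0"
      using *(1,2) by (simp_all add: Rspace_def)
    then show False
      using j by simp
  qed
  have "(\<Sum>i<d. (?l ?z i)\<^sup>2) < (\<Sum>i<d. (1 - u) * (?l x i)\<^sup>2 + u * (?l y i)\<^sup>2)"
  proof (rule sum_strict_mono_ex1)
    have "0 \<le> u * (1 - u) * (?l x i - ?l y i)\<^sup>2" for i
      using * by simp
    then show "\<forall>i\<in>{..<d}. (?l ?z i)\<^sup>2 \<le> (1 - u) * (?l x i)\<^sup>2 + u * (?l y i)\<^sup>2"
      by (metis gap diff_ge_0_iff_ge)
    have "0 < u * (1 - u) * (?l x j - ?l y j)\<^sup>2"
      using * j by simp
    then have "(?l ?z j)\<^sup>2 < (1 - u) * (?l x j)\<^sup>2 + u * (?l y j)\<^sup>2"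
      by (metis gap diff_gt_0_iff_gt)
    then show "\<exists>i\<in>{..<d}. (?l ?z i)\<^sup>2 < (1 - u) * (?l x i)\<^sup>2 + u * (?l y i)\<^sup>2"
      using \<open>j < d\<close> by blast
  qed simp
  also have "\<dots> = (1 - u) * (\<Sum>i<d. (?l x i)\<^sup>2) + u * (\<Sum>i<d. (?l y i)\<^sup>2)"
    by (simp add: sum.distrib sum_distrib_left)
  finally show "(\<Sum>i<d. (?l ?z i)\<^sup>2) < (1 - u) * (\<Sum>i<d. (?l x i)\<^sup>2) + u * (\<Sum>i<d. (?l y i)\<^sup>2)" .
qed

text \<open>
  Let \<open>X\<close> be spanned by one point of each nonempty cell, and let \<open>W i\<close> consist of the points of \<open>X\<close> whose
  \<open>e\<close>-neighbourhood in \<open>E\<close> lies in \<open>U i\<close>. This erosion is closed, and it inherits convexity because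
  neighbourhoods in a subspace are translates of one another. A Lebesgue number of the cover bounds
  the \<open>e\<close> for which the \<open>W i\<close> still cover \<open>X\<close>; the chosen points, being finitely many, survive for
  small \<open>e\<close>.
\<close>
lemma open_cover_compact_shrinking:
  fixes E :: "'b::real_normed_vector set"
  assumes E: "subspace E" and "finite V"
    and U: "\<And>i. i \<in> V \<Longrightarrow> convex (U i) \<and> openin (top_of_set E) (U i)"
    and union: "convex (\<Union>i\<in>V. U i)"
  obtains X W where "compact X" "convex X" "X \<subseteq> E"
    and "\<And>i. i \<in> V \<Longrightarrow> convex (W i) \<and> closed (W i)" and "X \<subseteq> (\<Union>i\<in>V. W i)"
    and "nerve_over V W X = nerve_over V U (\<Union>i\<in>V. U i)"
proof -
  let ?N = "nerve_over V U (\<Union>i\<in>V. U i)"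
  have "\<forall>i\<in>V. \<exists>G. open G \<and> U i = E \<inter> G"
    using U by (auto simp: openin_open)
  then obtain G where G: "\<And>i. i \<in> V \<Longrightarrow> open (G i)" "\<And>i. i \<in> V \<Longrightarrow> U i = E \<inter> G i"
    by metis
  have "\<forall>\<sigma>\<in>?N. \<exists>x. x \<in> (\<Union>i\<in>V. U i) \<inter> (\<Inter>i\<in>\<sigma>. U i)"
    unfolding nerve_over_def by blast
  then obtain x where x: "\<And>\<sigma>. \<sigma> \<in> ?N \<Longrightarrow> x \<sigma> \<in> (\<Union>i\<in>V. U i) \<inter> (\<Inter>i\<in>\<sigma>. U i)"
    by metis
  define X where "X = convex hull (x ` ?N)"
  have fin: "finite ?N"
    by (rule finite_nerve_over[OF \<open>finite V\<close>])
  have X: "compact X" "convex X"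
    using fin by (simp_all add: X_def finite_imp_compact_convex_hull)
  have XU: "X \<subseteq> (\<Union>i\<in>V. U i)"
    unfolding X_def using x union by (intro hull_minimal) auto
  have xX: "x \<sigma> \<in> X" if "\<sigma> \<in> ?N" for \<sigma>
    using that by (auto simp: X_def intro: hull_inc)
  have "X \<subseteq> \<Union>(G ` V)"
    using XU G(2) by blast
  then obtain e1 where e1: "0 < e1" "\<And>y. y \<in> X \<Longrightarrow> \<exists>B\<in>G ` V. ball y e1 \<subseteq> B"
    using Heine_Borel_lemma[OF X(1), of "G ` V"] G(1) by blast
  have "\<forall>\<sigma>\<in>?N. \<exists>e>0. ball (x \<sigma>) e \<subseteq> (\<Inter>i\<in>\<sigma>. G i)"
  proof
    fix \<sigma> assume \<sigma>: "\<sigma> \<in> ?N"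
    then have "\<sigma> \<subseteq> V" by (auto simp: nerve_over_def)
    then have "open (\<Inter>i\<in>\<sigma>. G i)"
      using G(1) finite_subset[OF _ \<open>finite V\<close>] by (intro open_INT) auto
    moreover have "x \<sigma> \<in> (\<Inter>i\<in>\<sigma>. G i)"
      using x[OF \<sigma>] G(2) \<open>\<sigma> \<subseteq> V\<close> by auto
    ultimately show "\<exists>e>0. ball (x \<sigma>) e \<subseteq> (\<Inter>i\<in>\<sigma>. G i)"
      using open_contains_ball by blast
  qed
  then obtain e2 where e2: "\<And>\<sigma>. \<sigma> \<in> ?N \<Longrightarrow> 0 < e2 \<sigma> \<and> ball (x \<sigma>) (e2 \<sigma>) \<subseteq> (\<Inter>i\<in>\<sigma>. G i)"
    by metis
  define e where "e = Min (insert e1 (e2 ` ?N))"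
  have e: "0 < e" "e \<le> e1" "\<And>\<sigma>. \<sigma> \<in> ?N \<Longrightarrow> e \<le> e2 \<sigma>"
    using fin e1(1) e2 by (auto simp: e_def)
  define W where "W = (\<lambda>i. {y \<in> X. \<forall>z\<in>E. dist y z < e \<longrightarrow> z \<in> U i})"
  have XE: "X \<subseteq> E"
    using XU G(2) by blast
  have W_sub: "W i \<subseteq> U i" for i
    using XE \<open>0 < e\<close> by (auto simp: W_def)
  have "closed (W i)" for i
  proof -
    have "W i = X \<inter> (\<Inter>z\<in>E - U i. {y. e \<le> dist y z})"
      by (auto simp: W_def simp flip: not_less)
    moreover have "closed (X \<inter> (\<Inter>z\<in>E - U i. {y. e \<le> dist y z}))"
      by (intro closed_Int closed_INT ballI closed_Collect_le continuous_intros
          compact_imp_closed X)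
    ultimately show ?thesis by (simp only:)
  qed
  moreover have "convex (W i)" if "i \<in> V" for i
    unfolding convex_alt
  proof (intro ballI allI impI)
    fix p q u assume *: "p \<in> W i" "q \<in> W i" "0 \<le> u \<and> u \<le> (1::real)"
    let ?m = "(1 - u) *\<^sub>R p + u *\<^sub>R q"
    have "?m \<in> X"
      using * X(2) by (auto simp: W_def convex_alt)
    moreover have "z \<in> U i" if z: "z \<in> E" "dist ?m z < e" for z
    proof -
      let ?v = "z - ?m"
      have "?v \<in> E"
        using z \<open>?m \<in> X\<close> XE subspace_diff[OF E] by blast
      then have "p + ?v \<in> E" "q + ?v \<in> E"
        using * XE subspace_add[OF E] by (auto simp: W_def)
      moreover have "dist p (p + ?v) < e" "dist q (q + ?v) < e"
        using z(2) by (simp_all add: dist_norm norm_minus_commute)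
      ultimately have "p + ?v \<in> U i" "q + ?v \<in> U i"
        using * by (auto simp: W_def)
      then have "(1 - u) *\<^sub>R (p + ?v) + u *\<^sub>R (q + ?v) \<in> U i"
        using U[OF \<open>i \<in> V\<close>] * by (simp add: convex_alt)
      moreover have "(1 - u) *\<^sub>R (p + ?v) + u *\<^sub>R (q + ?v) = z"
        by (simp add: algebra_simps)
      ultimately show ?thesis by simp
    qed
    ultimately show "?m \<in> W i"
      by (simp add: W_def)
  qed
  moreover have "X \<subseteq> (\<Union>i\<in>V. W i)"
  proof
    fix y assume "y \<in> X"
    then obtain i where i: "i \<in> V" "ball y e1 \<subseteq> G i"
      using e1(2) by blast
    have "y \<in> W i"
      using \<open>y \<in> X\<close> i G(2)[OF i(1)] e(2) by (auto simp: W_def subset_iff)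
    then show "y \<in> (\<Union>i\<in>V. W i)"
      using i by blast
  qed
  moreover have "nerve_over V W X = ?N"
  proof
    show "nerve_over V W X \<subseteq> ?N"
    proof
      fix \<sigma> assume "\<sigma> \<in> nerve_over V W X"
      then obtain y where y: "\<sigma> \<subseteq> V" "y \<in> X" "\<And>i. i \<in> \<sigma> \<Longrightarrow> y \<in> W i"
        unfolding nerve_over_def by blast
      show "\<sigma> \<in> ?N"
      proof (rule nerve_overI)
        show "y \<in> (\<Union>i\<in>V. U i)"
          using XU y(2) by (rule subsetD)
        show "y \<in> U i" if "i \<in> \<sigma>" for i
          using W_sub y(3)[OF that] by (rule subsetD)
      qed (rule y(1))
    qed
    show "?N \<subseteq> nerve_over V W X"
    proof
      fix \<sigma> assume \<sigma>: "\<sigma> \<in> ?N"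
      then have "\<sigma> \<subseteq> V" by (auto simp: nerve_over_def)
      have "x \<sigma> \<in> W i" if "i \<in> \<sigma>" for i
        unfolding W_def
      proof (intro CollectI conjI ballI impI)
        fix z assume "z \<in> E" "dist (x \<sigma>) z < e"
        moreover from this have "z \<in> ball (x \<sigma>) (e2 \<sigma>)"
          using e(3)[OF \<sigma>] by simp
        then have "z \<in> G i"
          using e2[OF \<sigma>] that by blast
        ultimately show "z \<in> U i"
          using G(2) that \<open>\<sigma> \<subseteq> V\<close> by blast
      qed (rule xX[OF \<sigma>])
      then show "\<sigma> \<in> nerve_over V W X"
        by (rule nerve_overI[OF \<open>\<sigma> \<subseteq> V\<close> xX[OF \<sigma>]])
    qed
  qed
  ultimately show thesis
    using that[of X W] X XE by blast
qed

lemma nerve_eq_nerve_over: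
  assumes "convex (\<Union>i\<in>V. U i)"
  shows "nerve V U = nerve_over V U (\<Union>i\<in>V. U i)"
proof -
  have "nerve_cell V U \<sigma> = (\<Union>i\<in>V. U i) \<inter> (\<Inter>i\<in>\<sigma>. U i)" if "\<sigma> \<subseteq> V" for \<sigma>
    using that hull_same[of convex, OF assms] by (auto simp: nerve_cell_def)
  then show ?thesis
    unfolding nerve_def nerve_over_def by (intro Collect_cong conj_cong refl) simp
qed

section \<open>Stars\<close>

lemma nerve_over_cell_eq_star:
  assumes "\<sigma> \<subseteq> V"
  shows "nerve_over V U (X \<inter> (\<Inter>i\<in>\<sigma>. U i)) = star (nerve_over V U X) \<sigma>"
proof -
  define meets where "meets \<tau> \<longleftrightarrow> X \<inter> (\<Inter>i\<in>\<tau>. U i) \<noteq> {}" for \<tau>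
  have "X \<inter> (\<Inter>i\<in>\<sigma>. U i) \<inter> (\<Inter>i\<in>\<tau>. U i) \<noteq> {} \<longleftrightarrow> meets (\<tau> \<union> \<sigma>)" for \<tau>
    by (simp add: meets_def INT_Un Int_ac)
  moreover have "meets \<tau>" if "meets (\<tau> \<union> \<sigma>)" for \<tau>
    using that unfolding meets_def by blast
  ultimately show ?thesis
    using assms by (auto simp: nerve_over_def star_def simp flip: meets_def)
qed

lemma star_collapses_onto_Pow:
  assumes "finite \<Delta>" and \<Delta>: "down_closed \<Delta>" and \<sigma>: "\<sigma> \<in> \<Delta>" and "\<sigma> \<noteq> {}"
  shows "collapses_onto (star \<Delta> \<sigma>) (Pow \<sigma>)"
proof -
  obtain a where a: "a \<in> \<sigma>"
    using \<open>\<sigma> \<noteq> {}\<close> by blast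
  let ?K = "{\<tau> \<in> star \<Delta> \<sigma>. a \<notin> \<tau>}"
  have dc: "\<tau> \<in> star \<Delta> \<sigma>" if "\<rho> \<in> star \<Delta> \<sigma>" "\<tau> \<subseteq> insert a \<rho>" for \<rho> \<tau>
  proof -
    have "\<rho> \<union> \<sigma> \<in> \<Delta>" "\<tau> \<union> \<sigma> \<subseteq> \<rho> \<union> \<sigma>" "\<tau> \<subseteq> \<rho> \<union> \<sigma>"
      using that a by (auto simp: star_def)
    then show ?thesis
      using down_closedD[OF \<Delta>] by (auto simp: star_def)
  qed
  have "star \<Delta> \<sigma> = cone_over a ?K"
  proof
    show "star \<Delta> \<sigma> \<subseteq> cone_over a ?K"
    proof
      fix \<tau> assume \<tau>: "\<tau> \<in> star \<Delta> \<sigma>"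
      have "\<tau> - {a} \<in> ?K"
        using dc[OF \<tau>, of "\<tau> - {a}"] by blast
      moreover have "a \<in> \<tau> \<Longrightarrow> \<tau> = insert a (\<tau> - {a})"
        by blast
      ultimately show "\<tau> \<in> cone_over a ?K"
        using \<tau> unfolding cone_over_def by blast
    qed
    show "cone_over a ?K \<subseteq> star \<Delta> \<sigma>"
      using dc unfolding cone_over_def by blast
  qed
  moreover have "Pow \<sigma> = cone_over a (Pow (\<sigma> - {a}))"
    using Pow_insert[of a "\<sigma> - {a}"] a by (simp add: cone_over_def insert_absorb)
  moreover have "collapses_onto (cone_over a ?K) (cone_over a (Pow (\<sigma> - {a})))"
  proof (rule cone_over_collapses_onto)
    show "finite ?K"
      using \<open>finite \<Delta>\<close> by (simp add: star_def)
    show "down_closed ?K"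
      using dc unfolding down_closed_def by blast
    show "down_closed (Pow (\<sigma> - {a}))"
      by (auto simp: down_closed_def)
    have "\<sigma> \<in> star \<Delta> \<sigma>"
      using \<sigma> by (simp add: star_def)
    then show "Pow (\<sigma> - {a}) \<subseteq> ?K"
      using dc[of \<sigma>] by auto
  qed auto
  ultimately show ?thesis by simp
qed

theorem corollary3p3:
  fixes V :: "'a set" and \<Delta> :: "'a set set" and \<sigma> :: "'a set"
  assumes "abstract_simplicial_complex V \<Delta>"
    and "convex_union_representable V \<Delta>"
    and "\<sigma> \<in> \<Delta>"
  shows "collapses_onto \<Delta> (star \<Delta> \<sigma>) \<and> (\<sigma> \<noteq> {} \<longrightarrow> collapses_onto \<Delta> (Pow \<sigma>))"
proof -
  have "finite V" and \<sigma>V: "\<sigma> \<subseteq> V" and "down_closed \<Delta>"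
    using assms(1,3) by (auto simp: abstract_simplicial_complex_def down_closed_def)
  obtain d and U :: "'a \<Rightarrow> (nat \<Rightarrow>\<^sub>0 real) set"
    where U: "\<And>i. i \<in> V \<Longrightarrow> convex (U i) \<and> openin (top_of_set (Rspace d)) (U i)"
      and union: "convex (\<Union>i\<in>V. U i)" and \<Delta>: "\<Delta> = nerve V U"
    using assms(2) unfolding convex_union_representable_def d_convex_union_representable_def
    by blast
  obtain X W where X: "compact X" "convex X" "X \<subseteq> Rspace d"
    and W: "\<And>i. i \<in> V \<Longrightarrow> convex (W i) \<and> closed (W i)" and cover: "X \<subseteq> (\<Union>i\<in>V. W i)"
    and nerve: "nerve_over V W X = nerve_over V U (\<Union>i\<in>V. U i)"
    using open_cover_compact_shrinking[OF subspace_Rspace \<open>finite V\<close> U union] by metis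
  have \<Delta>W: "\<Delta> = nerve_over V W X"
    using \<Delta> nerve nerve_eq_nerve_over[OF union] by simp
  have "collapses_onto (nerve_over V W X) (nerve_over V W (X \<inter> (\<Inter>i\<in>\<sigma>. W i)))"
  proof (rule nerve_over_collapses_onto_convex_subset[where E = "Rspace d"])
    show "continuous_on (Rspace d) (\<lambda>x. \<Sum>i<d. (Poly_Mapping.lookup x i)\<^sup>2)"
      by (intro continuous_intros continuous_on_lookup)
    show "convex (\<Inter>i\<in>\<sigma>. W i)" "closed (\<Inter>i\<in>\<sigma>. W i)"
      using W \<sigma>V by (auto intro!: convex_INT closed_INT)
    show "X - (\<Inter>i\<in>\<sigma>. W i) \<subseteq> (\<Union>i\<in>V. W i)"
      using cover by blast
  qed (use strictly_convex_on_sum_squares \<open>finite V\<close> W X in auto)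
  then have "collapses_onto \<Delta> (star \<Delta> \<sigma>)"
    using \<Delta>W nerve_over_cell_eq_star[OF \<sigma>V] by metis
  moreover have "collapses_onto (star \<Delta> \<sigma>) (Pow \<sigma>)" if "\<sigma> \<noteq> {}"
  proof (rule star_collapses_onto_Pow)
    show "finite \<Delta>"
      unfolding \<Delta>W by (rule finite_nerve_over[OF \<open>finite V\<close>])
  qed fact+
  ultimately show ?thesis
    using collapses_onto_trans by blast
qed

end
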